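(* For every integer $n \geq 1$, $$Ch_{n,\frac{1}{2}} = \sum_{m=0}^n \binom{n}{m} C_m\, Ch_{n-m,\frac{1}{2}}\,(-1)^m \frac{(m+1)!}{4^m(2m-1)},$$ and $Ch_{0,\frac12} = 1$.
   Context: $C_n = \frac{1}{n+1}\binom{2n}{n}$ is the $n$-th Catalan number. The $\frac12$-Changhee numbers $Ch_{n,\frac12}$ are defined by the formal power series identity $\frac{2}{1+\sqrt{1+t}} = \sum_{n\ge 0} Ch_{n,\frac12}\frac{t^n}{n!}$, where $\sqrt{1+t} = (1+t)^{1/2} = \sum_{n\ge0}\binom{1/2}{n}t^n$. *)

theory Defs
  imports Complex_Main "HOL-Computational_Algebra.Formal_Power_Series"
begin

definition catalan :: "nat \<Rightarrow> real" where
  "catalan n = 1 / (real n + 1) * real ((2 * n) choose n)"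

text \<open>
  The series \<^term>\<open>fps_binomial (1/2)\<close> is the binomial series of (1+t)^(1/2).
\<close>

definition changhee_half_fps :: "real fps" where
  "changhee_half_fps = 2 / (1 + fps_binomial (1/2))"

definition changhee_half :: "nat \<Rightarrow> real" where
  "changhee_half n = fact n * fps_nth changhee_half_fps n"

lemma changhee_half_egf:
  "2 / (1 + fps_binomial (1/2)) = Abs_fps (\<lambda>n. changhee_half n / fact n)"
  by (simp add: fps_eq_iff changhee_half_def changhee_half_fps_def)

text \<open>
  The constant term of the denominator is 2, so the quotient is the genuine one.
\<close>

lemma changhee_half_fps_mult: "changhee_half_fps * (1 + fps_binomial (1/2)) = 2"
proof -
  have "fps_nth (1 + fps_binomial (1/2 :: real)) 0 \<noteq> 0"
    by simp
  hence "is_unit (1 + fps_binomial (1/2 :: real))"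
    by (simp only: fps_is_unit_iff not_False_eq_True)
  thus ?thesis
    unfolding changhee_half_fps_def by (simp add: unit_div_mult_self)
qed

end

theory Submission
  imports Defs
begin

text \<open>
  Since $(m+1) C_m = \binom{2m}{m}$, the coefficient $(-1)^m (m+1) C_m / (4^m (2m-1))$ equals
  $-\binom{1/2}{m}$. The recurrence is thus the coefficient form of $f = 2 - f \sqrt{1+t}$,
  where $f = 2 / (1 + \sqrt{1+t})$.
\<close>

text \<open>Writing central binomials as (2k)!/(k!)^2, the ratio of consecutive ones is
  (2n+2)(2n+1)/(n+1)^2. It drives the induction in \<open>gbinomial_half\<close>.\<close>

lemma central_binomial_Suc:
  "real ((2 * Suc n) choose Suc n) * (real n + 1) = 2 * (2 * real n + 1) * real ((2 * n) choose n)"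
proof -
  have binom: "real ((2 * k) choose k) = fact (2 * k) / (fact k * fact k)" for k
    by (simp add: binomial_fact mult_2)
  have fact_double: "(fact (2 * Suc n) :: real) = (2 * real n + 2) * (2 * real n + 1) * fact (2 * n)"
    by (simp add: algebra_simps)
  have "real n + 1 \<noteq> 0"
    by linarith
  then show ?thesis
    unfolding binom fact_double fact_Suc of_nat_Suc
    by (simp add: divide_simps) (simp add: algebra_simps)
qed

text \<open>Induction works because both sides gain the factor (1/2 - m)/(m+1) when m becomes
  m+1.\<close>

lemma gbinomial_half:
  "(1/2 :: real) gchoose m = - real ((2 * m) choose m) * (-1) ^ m / (4 ^ m * (2 * real m - 1))"
proof (induction m)
  case 0
  show ?case by simp
next
  case (Suc m)
  have ne: "2 * real m - 1 \<noteq> 0" "real m + 1 \<noteq> 0" "2 * real m + 1 \<noteq> 0"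
  proof -
    \<comment> \<open>Parity rules out a zero denominator 2m - 1; for m = 0 it is -1.\<close>
    have "2 * int m \<noteq> 1"
      by presburger
    then show "2 * real m - 1 \<noteq> 0"
      by linarith
  qed linarith+
  have "(1/2 :: real) gchoose Suc m = (1/2 gchoose m) * (1/2 - real m) / (real m + 1)"
    by (simp add: gbinomial_prod_rev add_ac)
  \<comment> \<open>Since 1/2 - m = -(2m - 1)/2, the denominator 2m - 1 and the leading sign
    cancel.\<close>
  also have "\<dots> = real ((2 * m) choose m) * (-1) ^ m / (2 * 4 ^ m * (real m + 1))"
    using ne by (simp add: Suc divide_simps) (simp add: algebra_simps)
  \<comment> \<open>Passing to the next central binomial cancels m + 1 and brings in 2m + 1 = 2(m+1)
    - 1, the denominator required at \<open>Suc m\<close>.\<close>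
  also have "real ((2 * m) choose m) =
      real ((2 * Suc m) choose Suc m) * (real m + 1) / (2 * (2 * real m + 1))"
    using central_binomial_Suc[of m] ne by (simp add: divide_simps del: binomial_Suc_Suc mult_Suc_right)
  finally show ?case
    using ne by (simp add: divide_simps del: binomial_Suc_Suc mult_Suc_right)
      (simp add: algebra_simps del: binomial_Suc_Suc mult_Suc_right)
qed

lemma changhee_half_fps_eq:
  "changhee_half_fps = 2 - fps_binomial (1/2) * changhee_half_fps"
  using changhee_half_fps_mult by (simp add: algebra_simps eq_diff_eq)

theorem theorem5:
  "(\<forall>n::nat. n \<ge> 1 \<longrightarrow>
      changhee_half n =
        (\<Sum>m=0..n. real (n choose m) * catalan m * changhee_half (n - m) * (-1) ^ m *
          (fact (m + 1) / (4 ^ m * (2 * real m - 1)))))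
   \<and> changhee_half 0 = 1"
proof (intro conjI allI impI)
  fix n :: nat
  assume n: "n \<ge> 1"
  have summand: "real (n choose m) * catalan m * changhee_half (n - m) * (-1) ^ m *
        (fact (m + 1) / (4 ^ m * (2 * real m - 1))) =
      - fact n * ((1/2 gchoose m) * fps_nth changhee_half_fps (n - m))" if "m \<le> n" for m
  proof -
    let ?f = "fps_nth changhee_half_fps (n - m)" and ?D = "4 ^ m * (2 * real m - 1)"
    have choose_fact: "real (n choose m) * (fact m * fact (n - m)) = fact n"
      using binomial_fact_lemma[OF that] by (metis mult.commute of_nat_fact of_nat_mult)
    \<comment> \<open>The 1/(m+1) in \<open>catalan m\<close> reduces (m+1)! to m!, which then joins
      (n-m)! and the binomial coefficient to form n!.\<close>
    have catalan_fact: "catalan m * fact (m + 1) = fact m * real ((2 * m) choose m)"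
      by (simp add: catalan_def divide_simps)
    have "real (n choose m) * catalan m * changhee_half (n - m) * (-1) ^ m * (fact (m + 1) / ?D) =
        real (n choose m) * (catalan m * fact (m + 1)) * fact (n - m) * ?f * ((-1) ^ m / ?D)"
      by (simp add: changhee_half_def mult_ac del: fact_Suc)
    also have "\<dots> = real (n choose m) * (fact m * fact (n - m)) *
        (real ((2 * m) choose m) * ?f * ((-1) ^ m / ?D))"
      unfolding catalan_fact by (simp only: mult_ac)
    also have "\<dots> = - fact n * ((1/2 gchoose m) * ?f)"
      unfolding choose_fact gbinomial_half by simp
    finally show ?thesis .
  qed
  \<comment> \<open>For n \<ge> 1 the constant series 2 contributes nothing. The equation is
    implicit: the m = 0 term of the product is the n-th coefficient itself.\<close>
  have "fps_nth changhee_half_fps n = - fps_nth (fps_binomial (1/2) * changhee_half_fps) n"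
    using n by (subst changhee_half_fps_eq) (simp add: numeral_fps_const)
  then have "changhee_half n =
        (\<Sum>m=0..n. - fact n * ((1/2 gchoose m) * fps_nth changhee_half_fps (n - m)))"
    by (simp add: changhee_half_def fps_mult_nth sum_distrib_left sum_negf)
  also have "\<dots> =
        (\<Sum>m=0..n. real (n choose m) * catalan m * changhee_half (n - m) * (-1) ^ m *
          (fact (m + 1) / (4 ^ m * (2 * real m - 1))))"
    by (intro sum.cong refl) (simp only: summand atLeastAtMost_iff)
  finally show "changhee_half n =
        (\<Sum>m=0..n. real (n choose m) * catalan m * changhee_half (n - m) * (-1) ^ m *
          (fact (m + 1) / (4 ^ m * (2 * real m - 1))))" .
next
  \<comment> \<open>The binomial series has constant term 1, so the factor 1 + \<surd>(1+t) has
    constant term 2.\<close>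
  have "fps_nth changhee_half_fps 0 * 2 = 2"
    using arg_cong[OF changhee_half_fps_mult, of "\<lambda>f. fps_nth f 0"] by simp
  then show "changhee_half 0 = 1"
    by (simp add: changhee_half_def)
qed

end
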